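(* Let $\tau$ be a composition of $n$. The assignment $[i]\mapsto\mathcal V_{\tau+(1^{i-n})}$ for $i\ge n$ and $[i]\mapsto0$ for $i<n$, with the order preserving injection $\iota_{i,i+1}$ from degree $i$ to degree $i+1$ acting by $\Phi_i$ (for $i\ge n$), is an $\mathcal H$-module.
   Context: Fix a field $\mathbf k$. For $n\ge 0$ let $[n]=\{1,\dots,n\}$, and let $H_n(0)$ be the unital associative $\mathbf k$-algebra generated by $\pi_1,\dots,\pi_{n-1}$ with relations $\pi_i^2=\pi_i$, $\pi_i\pi_{i+1}\pi_i=\pi_{i+1}\pi_i\pi_{i+1}$, and $\pi_i\pi_j=\pi_j\pi_i$ for $|i-j|>1$. For $w\in\mathfrak S_n$ with reduced expression $w=s_{i_1}\cdots s_{i_r}$ in the adjacent transpositions $s_i=(i,i+1)$, put $\pi_w=\pi_{i_1}\cdots\pi_{i_r}$; the $\pi_w$ form a basis of $H_n(0)$ and a monoid $\mathcal M_n$ under multiplication. For $n\le m$, $\mathcal M_n\subseteq\mathcal M_m$ via $\pi_i\mapsto\pi_i$. The $0$-Hecke category $\mathcal H$ has objects $[n]$, $n\ge0$. For $n\le m$, $\mathrm{Hom}_{\mathcal H}([n],[m])$ is the set of braid diagrams from $n$ top vertices to $m$ bottom vertices with only positive crossings, modulo $\pi_i^2=\pi_i$, composed by padding with dummy strands, multiplying in the $0$-Hecke monoid and deleting dummy strands; there are no morphisms if $n>m$. Algebraically, $\mathrm{Hom}_{\mathcal H}([n],[m])$ is the quotient of $\mathcal M_m$ by the equivalence relation generated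 by $x\sim x\pi_j$ for $n+1\le j\le m-1$, and the composite of the class of $y\in\mathcal M_\ell$ in $\mathrm{Hom}([m],[\ell])$ with the class of $x\in\mathcal M_m$ in $\mathrm{Hom}([n],[m])$ is the class of $yx\in\mathcal M_\ell$. The principal injection $\iota_{n,m}$ is the class of $1$. An $\mathcal H$-module is a functor $V$ from $\mathcal H$ to $\mathbf k$-vector spaces; $V_n=V([n])$ is an $H_n(0)$-module since $\mathrm{End}_{\mathcal H}([n])=\mathcal M_n$. A composition $\alpha=(\alpha_1,\dots,\alpha_r)$ of $n$ is a sequence of positive integers with sum $n$; $\alpha+(1^d)$ denotes $\alpha$ followed by $d$ entries equal to $1$. The reverse composition diagram of $\alpha$ has left-justified rows with $\alpha_i$ boxes in row $i$ from the top; box $(i,j)$ is in row $i$, column $j$. A standard reverse composition tableau (SRCT) of shape $\alpha$ is a bijective filling $T$ of the boxes by $1,\dots,n$ such that: (1) entries in each row decrease from left to right; (2) entries in the first column increase from top to bottom; (3) if $i<j$ and $T(i,k)>T(j,k+1)$, then $T(i,k+1)$ exists and $T(i,k+1)>T(j,k+1)$. $\mathrm{SRCT}(\alpha)$ is the set of these. $\mathrm{Des}(T)=\{i\in[n-1]\mid i+1\text{ appears weakly right of }i\text{ in }T\}$. The entries $i,i+1$ are attacking in $T$ if they are in the same column, or they are in adjacent columns with $i+1$ strictly below and to the right of $i$. $\mathcal V_\alpha$ is the $\mathbf k$-vector space with basis $\mathrm{SRCT}(\alpha)$, with $H_n(0)$-action $\pi_i(T)=0$ if $i\notin\mathrm{Des}(T)$;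 $\pi_i(T)=T$ if $i\in\mathrm{Des}(T)$ and $i,i+1$ are attacking; $\pi_i(T)=s_i(T)+T$ if $i\in\mathrm{Des}(T)$ and $i,i+1$ are non-attacking, where $s_i(T)$ interchanges the entries $i$ and $i+1$. For a composition $\alpha$ of $i$, the map $\Phi_i:\mathcal V_\alpha\to\mathcal V_{\alpha+(1)}$ sends $T\in\mathrm{SRCT}(\alpha)$ to the SRCT of shape $\alpha+(1)$ obtained by filling the boxes of $\alpha$ as in $T$ and placing $i+1$ in the new box. *)

theory Defs
  imports Complex_Main "HOL-Library.Poly_Mapping" "HOL-Combinatorics.Transposition"
begin

section \<open>The 0-Hecke monoid and the 0-Hecke category\<close>

text \<open>
  Elements of the monoid \<open>\<M>\<^sub>n\<close> are represented by words: the list \<open>[i\<^sub>1, \<dots>, i\<^sub>r]\<close> stands for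
  \<open>\<pi>\<^bsub>i\<^sub>1\<^esub> \<cdots> \<pi>\<^bsub>i\<^sub>r\<^esub>\<close>. All defining relations of \<open>H\<^sub>n(0)\<close> equate two words, so \<open>H\<^sub>n(0)\<close> is the monoid
  algebra of the monoid with the same generators and relations, and \<open>\<M>\<^sub>n\<close>, the multiplicative monoid
  generated by the \<open>\<pi>\<^sub>i\<close> in \<open>H\<^sub>n(0)\<close>, is that monoid. It does not depend on the field.
\<close>

inductive hecke_eq :: "nat \<Rightarrow> nat list \<Rightarrow> nat list \<Rightarrow> bool" for n :: nat where
  idem: "i \<in> {1..<n} \<Longrightarrow> hecke_eq n [i, i] [i]"
| braid: "i \<in> {1..<n} \<Longrightarrow> i + 1 \<in> {1..<n} \<Longrightarrow> hecke_eq n [i, i + 1, i] [i + 1, i, i + 1]"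
| comm: "i \<in> {1..<n} \<Longrightarrow> j \<in> {1..<n} \<Longrightarrow> \<bar>int i - int j\<bar> > 1 \<Longrightarrow> hecke_eq n [i, j] [j, i]"
| mult: "hecke_eq n u v \<Longrightarrow> a \<in> lists {1..<n} \<Longrightarrow> b \<in> lists {1..<n} \<Longrightarrow>
    hecke_eq n (a @ u @ b) (a @ v @ b)"
| refl: "u \<in> lists {1..<n} \<Longrightarrow> hecke_eq n u u"
| sym: "hecke_eq n u v \<Longrightarrow> hecke_eq n v u"
| trans: "hecke_eq n u v \<Longrightarrow> hecke_eq n v w \<Longrightarrow> hecke_eq n u w"

text \<open>
  The equivalence relation on \<open>\<M>\<^sub>m\<close> generated by \<open>x \<sim> x \<pi>\<^sub>j\<close> for \<open>n + 1 \<le> j \<le> m - 1\<close>, pulled back to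
  words. A morphism \<open>[n] \<rightarrow> [m]\<close> is thus an equivalence class of words in \<open>1, \<dots>, m - 1\<close>. For \<open>n = m\<close>
  there is no such \<open>j\<close>, so the endomorphisms of \<open>[n]\<close> are the elements of \<open>\<M>\<^sub>n\<close>.
\<close>

inductive hom_eq :: "nat \<Rightarrow> nat \<Rightarrow> nat list \<Rightarrow> nat list \<Rightarrow> bool" for n m :: nat where
  hecke: "hecke_eq m u v \<Longrightarrow> hom_eq n m u v"
| pad: "u \<in> lists {1..<m} \<Longrightarrow> j \<in> {n + 1..<m} \<Longrightarrow> hom_eq n m u (u @ [j])"
| sym: "hom_eq n m u v \<Longrightarrow> hom_eq n m v u"
| trans: "hom_eq n m u v \<Longrightarrow> hom_eq n m v w \<Longrightarrow> hom_eq n m u w"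

definition mor :: "nat \<Rightarrow> nat \<Rightarrow> nat list \<Rightarrow> nat list set" where
  "mor n m u = {v. hom_eq n m u v}"

definition Hom :: "nat \<Rightarrow> nat \<Rightarrow> nat list set set" where
  "Hom n m = (if n \<le> m then mor n m ` lists {1..<m} else {})"

definition Hcomp :: "nat \<Rightarrow> nat \<Rightarrow> nat list set \<Rightarrow> nat list set \<Rightarrow> nat list set" where
  "Hcomp n l g f = {w. \<exists>y\<in>g. \<exists>x\<in>f. hom_eq n l (y @ x) w}"

definition \<iota> :: "nat \<Rightarrow> nat \<Rightarrow> nat list set" where
  "\<iota> n m = mor n m []"

lemma hecke_eq_lists:
  assumes "hecke_eq n u v"
  shows "u \<in> lists {1..<n} \<and> v \<in> lists {1..<n}"
  using assms by induction auto

lemma hom_eq_lists: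
  assumes "hom_eq n m u v"
  shows "u \<in> lists {1..<m} \<and> v \<in> lists {1..<m}"
  using assms
proof induction
  case (hecke u v)
  then show ?case by (rule hecke_eq_lists)
qed auto

lemma hom_eq_refl: "u \<in> lists {1..<m} \<Longrightarrow> hom_eq n m u u"
  by (intro hom_eq.hecke hecke_eq.refl)

lemma mor_eq_iff:
  assumes "u \<in> lists {1..<m}" "v \<in> lists {1..<m}"
  shows "mor n m u = mor n m v \<longleftrightarrow> hom_eq n m u v"
proof
  assume "mor n m u = mor n m v"
  then show "hom_eq n m u v"
    unfolding mor_def using hom_eq_refl[OF assms(2), of n] by blast
next
  assume "hom_eq n m u v"
  then show "mor n m u = mor n m v"
    unfolding mor_def using hom_eq.trans[of n m u v] hom_eq.trans[of n m v u] hom_eq.sym[of n m u v]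
    by blast
qed

lemma hecke_eq_mono:
  assumes "hecke_eq m u v" "m \<le> l"
  shows "hecke_eq l u v"
  using assms(1)
proof induction
  case (mult u v a b)
  then show ?case using assms(2) by (auto intro!: hecke_eq.mult)
next
  case (sym u v)
  show ?case by (rule hecke_eq.sym[OF sym.IH])
next
  case (trans u v w)
  show ?case by (rule hecke_eq.trans[OF trans.IH])
next
  case (braid i)
  then show ?case using assms(2) by (intro hecke_eq.braid) auto
next
  case (refl u)
  then show ?case using assms(2) by (intro hecke_eq.refl) auto
qed (use assms(2) in \<open>auto intro: hecke_eq.idem hecke_eq.comm\<close>)

lemma hecke_eq_commute_past:
  assumes "x \<in> lists {1..<m}" "j \<in> {m + 1..<l}"
  shows "hecke_eq l (j # x) (x @ [j])"
  using assms(1)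
proof (induction x)
  case Nil
  then show ?case using assms(2) by (auto intro!: hecke_eq.refl)
next
  case (Cons i x)
  have 1: "hecke_eq l ([] @ [j, i] @ x) ([] @ [i, j] @ x)"
    using Cons.hyps assms(2)
    by (intro hecke_eq.mult hecke_eq.comm) auto
  have 2: "hecke_eq l ([i] @ (j # x) @ []) ([i] @ (x @ [j]) @ [])"
    using Cons assms(2) by (intro hecke_eq.mult) auto
  show ?case using hecke_eq.trans[OF 1] 2 by simp
qed

lemma hom_eq_append_left:
  assumes "hom_eq n m x x'" "m \<le> l" "y \<in> lists {1..<l}"
  shows "hom_eq n l (y @ x) (y @ x')"
  using assms(1)
proof induction
  case (hecke u v)
  then have "hecke_eq l (y @ u @ []) (y @ v @ [])"
    using assms by (intro hecke_eq.mult hecke_eq_mono[OF hecke]) auto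
  then show ?case by (auto intro: hom_eq.hecke)
next
  case (pad u j)
  then have "hom_eq n l (y @ u) ((y @ u) @ [j])"
    using assms by (intro hom_eq.pad) auto
  then show ?case by simp
next
  case (sym u v)
  show ?case by (rule hom_eq.sym[OF sym.IH])
next
  case (trans u v w)
  show ?case by (rule hom_eq.trans[OF trans.IH])
qed

lemma hom_eq_append_right:
  assumes "hom_eq m l y y'" "n \<le> m" "m \<le> l" "x \<in> lists {1..<m}"
  shows "hom_eq n l (y @ x) (y' @ x)"
proof -
  have x: "x \<in> lists {1..<l}" using assms by auto
  show ?thesis using assms(1)
  proof induction
    case (hecke u v)
    then have "hecke_eq l ([] @ u @ x) ([] @ v @ x)"
      using x by (intro hecke_eq.mult) auto
    then show ?case by (auto intro: hom_eq.hecke)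
  next
    case (pad u j)
    then have 1: "hom_eq n l (u @ x) ((u @ x) @ [j])"
      using assms x by (intro hom_eq.pad) auto
    have "hecke_eq l (u @ (j # x) @ []) (u @ (x @ [j]) @ [])"
      using pad assms by (intro hecke_eq.mult hecke_eq_commute_past) auto
    then have 2: "hom_eq n l ((u @ x) @ [j]) ((u @ [j]) @ x)"
      by (auto intro: hom_eq.hecke hecke_eq.sym)
    show ?case using 1 2 by (rule hom_eq.trans)
  next
    case (sym u v)
    show ?case by (rule hom_eq.sym[OF sym.IH])
  next
    case (trans u v w)
    show ?case by (rule hom_eq.trans[OF trans.IH])
  qed
qed

lemma Hcomp_mor:
  assumes "n \<le> m" "m \<le> l" "x \<in> lists {1..<m}" "y \<in> lists {1..<l}"
  shows "Hcomp n l (mor m l y) (mor n m x) = mor n l (y @ x)"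
proof -
  have 1: "hom_eq n l (y @ x) (y' @ x')" if "hom_eq m l y y'" "hom_eq n m x x'" for x' y'
  proof (rule hom_eq.trans)
    show "hom_eq n l (y @ x) (y' @ x)"
      using that(1) assms(1-3) by (rule hom_eq_append_right)
    show "hom_eq n l (y' @ x) (y' @ x')"
      using that(2) assms(2) hom_eq_lists[OF that(1)] by (intro hom_eq_append_left) auto
  qed
  have "hom_eq m l y y" "hom_eq n m x x"
    using assms by (auto intro: hom_eq_refl)
  then show ?thesis
    unfolding Hcomp_def mor_def
    using hom_eq.trans[OF 1] by blast
qed


section \<open>Modules over the 0-Hecke category\<close>

text \<open>
  A functor to vector spaces over the field \<open>'k\<close>. The vector space attached to \<open>[n]\<close> is a subspace
  \<open>V n\<close> of one ambient vector space (any sequence of vector spaces embeds into its direct sum), and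
  \<open>F n m f\<close> is the linear map \<open>V n \<rightarrow> V m\<close> induced by a morphism \<open>f : [n] \<rightarrow> [m]\<close>; the values of
  \<open>F n m f\<close> outside \<open>V n\<close> are irrelevant.
\<close>

locale H_module = vector_space scale
  for scale :: "'k::field \<Rightarrow> 'v::ab_group_add \<Rightarrow> 'v" +
  fixes V :: "nat \<Rightarrow> 'v set"
    and F :: "nat \<Rightarrow> nat \<Rightarrow> nat list set \<Rightarrow> 'v \<Rightarrow> 'v"
  assumes subspace_V: "subspace (V n)"
    and F_closed: "\<lbrakk>f \<in> Hom n m; v \<in> V n\<rbrakk> \<Longrightarrow> F n m f v \<in> V m"
    and F_add: "\<lbrakk>f \<in> Hom n m; v \<in> V n; w \<in> V n\<rbrakk> \<Longrightarrow> F n m f (v + w) = F n m f v + F n m f w"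
    and F_scale: "\<lbrakk>f \<in> Hom n m; v \<in> V n\<rbrakk> \<Longrightarrow> F n m f (scale c v) = scale c (F n m f v)"
    and F_id: "v \<in> V n \<Longrightarrow> F n n (mor n n []) v = v"
    and F_comp: "\<lbrakk>f \<in> Hom n m; g \<in> Hom m l; v \<in> V n\<rbrakk> \<Longrightarrow>
      F n l (Hcomp n l g f) v = F m l g (F n m f v)"


section \<open>Standard reverse composition tableaux\<close>

definition is_composition :: "nat list \<Rightarrow> nat \<Rightarrow> bool" where
  "is_composition \<alpha> n \<longleftrightarrow> (\<forall>a\<in>set \<alpha>. 0 < a) \<and> sum_list \<alpha> = n"

definition diagram :: "nat list \<Rightarrow> (nat \<times> nat) set" where
  "diagram \<alpha> = {(i, j). 1 \<le> i \<and> i \<le> length \<alpha> \<and> 1 \<le> j \<and> j \<le> \<alpha> ! (i - 1)}"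

text \<open>A filling assigns entries to boxes (row, column); it is \<open>0\<close> outside the diagram.\<close>

type_synonym filling = "nat \<times> nat \<Rightarrow> nat"

definition SRCT :: "nat list \<Rightarrow> filling set" where
  "SRCT \<alpha> = {T.
     bij_betw T (diagram \<alpha>) {1..sum_list \<alpha>} \<and>
     (\<forall>b. b \<notin> diagram \<alpha> \<longrightarrow> T b = 0) \<and>
     (\<forall>i j j'. (i, j) \<in> diagram \<alpha> \<and> (i, j') \<in> diagram \<alpha> \<and> j < j' \<longrightarrow> T (i, j) > T (i, j')) \<and>
     (\<forall>i i'. (i, 1) \<in> diagram \<alpha> \<and> (i', 1) \<in> diagram \<alpha> \<and> i < i' \<longrightarrow> T (i, 1) < T (i', 1)) \<and>
     (\<forall>i j k. (i, k) \<in> diagram \<alpha> \<and> (j, k + 1) \<in> diagram \<alpha> \<and> i < j \<and> T (i, k) > T (j, k + 1) \<longrightarrow>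
        (i, k + 1) \<in> diagram \<alpha> \<and> T (i, k + 1) > T (j, k + 1))}"

definition row_of :: "nat list \<Rightarrow> filling \<Rightarrow> nat \<Rightarrow> nat" where
  "row_of \<alpha> T a = fst (the_inv_into (diagram \<alpha>) T a)"

definition col_of :: "nat list \<Rightarrow> filling \<Rightarrow> nat \<Rightarrow> nat" where
  "col_of \<alpha> T a = snd (the_inv_into (diagram \<alpha>) T a)"

definition Des :: "nat list \<Rightarrow> filling \<Rightarrow> nat set" where
  "Des \<alpha> T = {i \<in> {1..<sum_list \<alpha>}. col_of \<alpha> T i \<le> col_of \<alpha> T (i + 1)}"

definition attacking :: "nat list \<Rightarrow> filling \<Rightarrow> nat \<Rightarrow> bool" where
  "attacking \<alpha> T i \<longleftrightarrow>
     col_of \<alpha> T i = col_of \<alpha> T (i + 1) \<or>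
     (col_of \<alpha> T (i + 1) = col_of \<alpha> T i + 1 \<and> row_of \<alpha> T i < row_of \<alpha> T (i + 1))"

definition swap_entries :: "nat \<Rightarrow> filling \<Rightarrow> filling" where
  "swap_entries i T = transpose i (i + 1) \<circ> T"


section \<open>The modules \<open>\<V>\<^sub>\<alpha>\<close> and the maps \<open>\<Phi>\<^sub>i\<close>\<close>

definition vscale :: "'k::field \<Rightarrow> ('a \<Rightarrow>\<^sub>0 'k) \<Rightarrow> ('a \<Rightarrow>\<^sub>0 'k)" where
  "vscale c v = Poly_Mapping.map ((*) c) v"

definition basis_vec :: "'a \<Rightarrow> ('a \<Rightarrow>\<^sub>0 'k::field)" where
  "basis_vec T = Poly_Mapping.single T 1"

definition linear_ext :: "('a \<Rightarrow> ('b \<Rightarrow>\<^sub>0 'k::field)) \<Rightarrow> ('a \<Rightarrow>\<^sub>0 'k) \<Rightarrow> ('b \<Rightarrow>\<^sub>0 'k)" where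
  "linear_ext f v = (\<Sum>T\<in>Poly_Mapping.keys v. vscale (Poly_Mapping.lookup v T) (f T))"

definition V_comp :: "nat list \<Rightarrow> (filling \<Rightarrow>\<^sub>0 'k::field) set" where
  "V_comp \<alpha> = {v. Poly_Mapping.keys v \<subseteq> SRCT \<alpha>}"

definition hecke_act :: "nat list \<Rightarrow> nat \<Rightarrow> (filling \<Rightarrow>\<^sub>0 'k::field) \<Rightarrow> (filling \<Rightarrow>\<^sub>0 'k)" where
  "hecke_act \<alpha> i = linear_ext (\<lambda>T.
     if i \<notin> Des \<alpha> T then 0
     else if attacking \<alpha> T i then basis_vec T
     else basis_vec (swap_entries i T) + basis_vec T)"

definition add_box :: "nat list \<Rightarrow> filling \<Rightarrow> filling" where
  "add_box \<alpha> T = T((length \<alpha> + 1, 1) := sum_list \<alpha> + 1)"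

definition \<Phi> :: "nat list \<Rightarrow> (filling \<Rightarrow>\<^sub>0 'k::field) \<Rightarrow> (filling \<Rightarrow>\<^sub>0 'k)" where
  "\<Phi> \<alpha> = linear_ext (\<lambda>T. basis_vec (add_box \<alpha> T))"

definition add_ones :: "nat list \<Rightarrow> nat \<Rightarrow> nat list" where
  "add_ones \<alpha> d = \<alpha> @ replicate d 1"

end

theory Submission
  imports Defs
begin

text \<open>
  On an injective filling, \<open>\<pi>\<^sub>i\<close> depends only on the boxes \<open>p\<close>, \<open>q\<close> holding \<open>i\<close> and \<open>i + 1\<close>: call the
  pair inverted if \<open>q\<close> is strictly left of \<open>p\<close>, and free if \<open>i\<close> is a non-attacking descent. The
  Hecke relations already hold on the span of all injective fillings; the only geometric inputs are
  that reversing a free pair inverts it and that if \<open>(p, q)\<close> and \<open>(q, r)\<close> are free then so is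
  \<open>(p, r)\<close>. The tableau conditions serve only to make the span of \<open>SRCT \<alpha>\<close> invariant: swapping a
  free pair reverses no comparison which they mention. Finally \<open>\<Phi>\<close> commutes with the old generators,
  and two successive new boxes lie in the same column, so the generator exchanging them fixes the
  image; this is exactly what a functor on the 0-Hecke category requires.
\<close>

section \<open>Functors on the 0-Hecke category from towers of 0-Hecke modules\<close>

text \<open>The data of a functor in terms of generators: 0-Hecke modules \<open>V n\<close>, maps
  \<open>up n\<close> commuting with the generators already present, and triviality of the generator
  exchanging two freshly added points. Linearity is asked on the ambient space, the relations only
  on \<open>V n\<close>.\<close>

locale hecke_tower = vector_space scale
  for scale :: "'k::field \<Rightarrow> 'v::ab_group_add \<Rightarrow> 'v" +
  fixes V :: "nat \<Rightarrow> 'v set"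
    and P :: "nat \<Rightarrow> nat \<Rightarrow> 'v \<Rightarrow> 'v"
    and up :: "nat \<Rightarrow> 'v \<Rightarrow> 'v"
  assumes subspace_V: "subspace (V n)"
    and linear_P: "Vector_Spaces.linear scale scale (P n i)"
    and linear_up: "Vector_Spaces.linear scale scale (up n)"
    and P_closed: "i \<in> {1..<n} \<Longrightarrow> v \<in> V n \<Longrightarrow> P n i v \<in> V n"
    and up_closed: "v \<in> V n \<Longrightarrow> up n v \<in> V (Suc n)"
    and P_idem: "i \<in> {1..<n} \<Longrightarrow> v \<in> V n \<Longrightarrow> P n i (P n i v) = P n i v"
    and P_braid: "i \<in> {1..<n} \<Longrightarrow> i + 1 \<in> {1..<n} \<Longrightarrow> v \<in> V n \<Longrightarrow>
      P n i (P n (i + 1) (P n i v)) = P n (i + 1) (P n i (P n (i + 1) v))"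
    and P_comm: "i \<in> {1..<n} \<Longrightarrow> j \<in> {1..<n} \<Longrightarrow> \<bar>int i - int j\<bar> > 1 \<Longrightarrow> v \<in> V n \<Longrightarrow>
      P n i (P n j v) = P n j (P n i v)"
    and P_up: "i \<in> {1..<n} \<Longrightarrow> v \<in> V n \<Longrightarrow> P (Suc n) i (up n v) = up n (P n i v)"
    and P_up_up: "v \<in> V n \<Longrightarrow>
      P (Suc (Suc n)) (Suc n) (up (Suc n) (up n v)) = up (Suc n) (up n v)"
begin

section \<open>Actions of words and of iterated injections\<close>

definition word_act :: "nat \<Rightarrow> nat list \<Rightarrow> 'v \<Rightarrow> 'v" where
  "word_act n = foldr (P n)"

primrec climb :: "nat \<Rightarrow> nat \<Rightarrow> 'v \<Rightarrow> 'v" where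
  "climb n 0 v = v"
| "climb n (Suc d) v = up (n + d) (climb n d v)"

text \<open>A morphism first climbs, then acts by a word. Any word of the class will do, by
  \<open>word_act_hom_eq\<close>; \<open>SOME\<close> picks it independently of \<open>v\<close>, so
  linearity holds for every set \<open>f\<close>.\<close>

definition hom_act :: "nat \<Rightarrow> nat \<Rightarrow> nat list set \<Rightarrow> 'v \<Rightarrow> 'v" where
  "hom_act n m f v = word_act m (SOME u. u \<in> f) (climb n (m - n) v)"

lemma word_act_simps [simp]:
  "word_act n [] v = v"
  "word_act n (i # u) v = P n i (word_act n u v)"
  "word_act n (u @ w) v = word_act n u (word_act n w v)"
  by (simp_all add: word_act_def)

lemma linear_word_act: "Vector_Spaces.linear scale scale (word_act n u)"
proof (induction u)
  case Nil
  have "word_act n [] = id" by auto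
  then show ?case using linear_id by metis
next
  case (Cons i u)
  have "word_act n (i # u) = P n i \<circ> word_act n u" by auto
  then show ?case
    using Vector_Spaces.linear_compose[OF Cons linear_P[of n i]] by metis
qed

lemma linear_climb: "Vector_Spaces.linear scale scale (climb n d)"
proof (induction d)
  case 0
  have "climb n 0 = id" by auto
  then show ?case using linear_id by metis
next
  case (Suc d)
  have "climb n (Suc d) = up (n + d) \<circ> climb n d" by auto
  then show ?case
    using Vector_Spaces.linear_compose[OF Suc linear_up[of "n + d"]] by metis
qed

lemma word_act_closed: "u \<in> lists {1..<n} \<Longrightarrow> v \<in> V n \<Longrightarrow> word_act n u v \<in> V n"
  by (induction u) (auto intro: P_closed)

lemma climb_closed: "v \<in> V n \<Longrightarrow> climb n d v \<in> V (n + d)"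
  by (induction d) (auto intro: up_closed)

lemma climb_add: "climb n (d + e) v = climb (n + d) e (climb n d v)"
  by (induction e) (auto simp: add.assoc)

lemma word_act_climb:
  assumes "u \<in> lists {1..<n}" "v \<in> V n"
  shows "word_act (n + d) u (climb n d v) = climb n d (word_act n u v)"
proof (induction d)
  case (Suc d)
  \<comment> \<open>The letters lie below \<open>n\<close>, so they are old generators at every step
    and pass \<open>up\<close> one by one.\<close>
  have "word_act (Suc (n + d)) w (up (n + d) x) = up (n + d) (word_act (n + d) w x)"
    if "w \<in> lists {1..<n}" "x \<in> V (n + d)" for w x
    using that
  proof (induction w)
    case (Cons i w)
    moreover have "word_act (n + d) w x \<in> V (n + d)"
      using Cons.hyps Cons.prems by (intro word_act_closed) auto
    ultimately show ?case by (auto intro!: P_up)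
  qed simp
  then show ?case using Suc climb_closed[OF assms(2)] assms(1) by simp
qed simp

text \<open>Induction with \<open>v\<close> arbitrary: in a context \<open>a @ u @ b\<close> the
  relation is applied to \<open>word_act n b v\<close>, which is again in
  \<open>V n\<close>.\<close>

lemma word_act_hecke_eq:
  assumes "hecke_eq n u w" "v \<in> V n"
  shows "word_act n u v = word_act n w v"
  using assms
proof (induction arbitrary: v)
  case (mult u w a b)
  then show ?case using word_act_closed by simp
qed (simp_all add: P_idem P_braid[simplified] P_comm)

text \<open>The generator \<open>j\<close> exchanges two points that were added one after the other.
  By \<open>P_up_up\<close> it fixes the vector as soon as both are present, and all later steps
  commute with it.\<close>

lemma P_climb:
  assumes "v \<in> V n" "j \<in> {n + 1..<n + d}"
  shows "P (n + d) j (climb n d v) = climb n d v"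
proof -
  \<comment> \<open>The climb has \<open>e\<close> steps before the two that reach degrees
    \<open>j\<close> and \<open>j + 1\<close>, and \<open>k\<close> steps after them.\<close>
  define e k where "e = j - Suc n" and "k = d - Suc (Suc e)"
  have d: "d = Suc (Suc e) + k" and j: "j = Suc (n + e)"
    using assms(2) by (auto simp: e_def k_def)
  define x where "x = climb n (Suc (Suc e)) v"
  have x: "x \<in> V (Suc (Suc (n + e)))"
    using climb_closed[OF assms(1), of "Suc (Suc e)"] by (simp add: x_def)
  have "P (Suc (Suc (n + e))) (Suc (n + e)) x = x"
    using P_up_up[OF climb_closed[OF assms(1)]] by (simp add: x_def)
  moreover have "P (Suc (Suc (n + e)) + k) j (climb (Suc (Suc (n + e))) k x) =
      climb (Suc (Suc (n + e))) k (P (Suc (Suc (n + e))) j x)"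
    using word_act_climb[of "[j]", OF _ x] j by simp
  ultimately show ?thesis
    using climb_add[of n "Suc (Suc e)" k v] unfolding d j x_def by (simp add: add.assoc)
qed

text \<open>A letter appended by padding acts first, directly on the climbed vector, where
  \<open>P_climb\<close> makes it trivial.\<close>

lemma word_act_hom_eq:
  assumes "hom_eq n m u w" "n \<le> m" "v \<in> V n"
  shows "word_act m u (climb n (m - n) v) = word_act m w (climb n (m - n) v)"
  using assms(1)
proof induction
  case (hecke u w)
  then show ?case
    using word_act_hecke_eq climb_closed[OF assms(3), of "m - n"] assms(2) by simp
next
  case (pad u j)
  then show ?case using P_climb[OF assms(3), of j "m - n"] assms(2) by simp
qed auto

lemma hom_act_mor:
  assumes "n \<le> m" "u \<in> lists {1..<m}" "v \<in> V n"
  shows "hom_act n m (mor n m u) v = word_act m u (climb n (m - n) v)"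
proof -
  have "(SOME w. w \<in> mor n m u) \<in> mor n m u"
    by (rule someI[of _ u]) (simp add: mor_def hom_eq_refl[OF assms(2)])
  then show ?thesis
    using word_act_hom_eq[OF _ assms(1,3)] by (simp add: hom_act_def mor_def)
qed

lemma H_module_hom_act: "H_module scale V hom_act"
proof unfold_locales
  have lin: "Vector_Spaces.linear scale scale (hom_act n m f)" for n m f
    using Vector_Spaces.linear_compose[OF linear_climb linear_word_act]
    by (simp add: hom_act_def[abs_def] comp_def)
  show "subspace (V n)" for n by (rule subspace_V)
  show "hom_act n m f (v + w) = hom_act n m f v + hom_act n m f w" for n m f v w
    using lin by (simp add: Vector_Spaces.linear_iff)
  show "hom_act n m f (scale c v) = scale c (hom_act n m f v)" for n m f v c
    using lin by (simp add: Vector_Spaces.linear_iff)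
  show "hom_act n n (mor n n []) v = v" if "v \<in> V n" for n v
    using hom_act_mor[of n n "[]" v] that by simp
  show "hom_act n m f v \<in> V m" if "f \<in> Hom n m" "v \<in> V n" for n m f v
  proof -
    from that(1) obtain u where "n \<le> m" "u \<in> lists {1..<m}" "f = mor n m u"
      by (auto simp: Hom_def split: if_splits)
    then show ?thesis
      using hom_act_mor that(2) word_act_closed climb_closed[OF that(2), of "m - n"] by simp
  qed
  show "hom_act n l (Hcomp n l g f) v = hom_act m l g (hom_act n m f v)"
    if f: "f \<in> Hom n m" and g: "g \<in> Hom m l" and v: "v \<in> V n" for n m l f g v
  proof -
    from f obtain x where x: "n \<le> m" "x \<in> lists {1..<m}" "f = mor n m x"
      by (auto simp: Hom_def split: if_splits)
    from g obtain y where y: "m \<le> l" "y \<in> lists {1..<l}" "g = mor m l y"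
      by (auto simp: Hom_def split: if_splits)
    have yx: "y @ x \<in> lists {1..<l}" using x y by auto
    define w where "w = climb n (m - n) v"
    have w: "w \<in> V m" using climb_closed[OF v, of "m - n"] x(1) by (simp add: w_def)
    have "climb n (l - n) v = climb m (l - m) w"
      using climb_add[of n "m - n" "l - m" v] x(1) y(1) by (simp add: w_def)
    then have "hom_act n l (Hcomp n l g f) v = word_act l y (word_act l x (climb m (l - m) w))"
      using hom_act_mor[OF _ yx v] Hcomp_mor[OF x(1) y(1) x(2) y(2)] x y by simp
    \<comment> \<open>The letters of \<open>x\<close> lie below \<open>m\<close>, so
      \<open>x\<close> slides past the climb from \<open>m\<close> to \<open>l\<close>; this mirrors
      padding with dummy strands.\<close>
    also have "\<dots> = word_act l y (climb m (l - m) (word_act m x w))"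
      using word_act_climb[OF x(2) w, of "l - m"] y(1) by simp
    also have "\<dots> = hom_act m l g (hom_act n m f v)"
      using x y v hom_act_mor[OF x(1,2) v] hom_act_mor[OF y(1,2)] word_act_closed[OF x(2) w]
      by (simp add: w_def)
    finally show ?thesis .
  qed
qed

end


section \<open>Spans of basis vectors\<close>

lemma lookup_vscale [simp]: "Poly_Mapping.lookup (vscale c v) x = c * Poly_Mapping.lookup v x"
  by (simp add: vscale_def Poly_Mapping.map.rep_eq when_def)

lemma vector_space_vscale: "vector_space (vscale :: 'k::field \<Rightarrow> ('a \<Rightarrow>\<^sub>0 'k) \<Rightarrow> _)"
  by unfold_locales (auto intro!: poly_mapping_eqI simp: lookup_add algebra_simps)

interpretation pm: vector_space "vscale :: 'k::field \<Rightarrow> ('a \<Rightarrow>\<^sub>0 'k) \<Rightarrow> _"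
  by (rule vector_space_vscale)

interpretation pmp: vector_space_pair
  "vscale :: 'k::field \<Rightarrow> ('a \<Rightarrow>\<^sub>0 'k) \<Rightarrow> _" "vscale :: 'k \<Rightarrow> ('b \<Rightarrow>\<^sub>0 'k) \<Rightarrow> _"
  by unfold_locales

text \<open>The extra terms have coefficient \<open>0\<close>. A common index set is needed because
  sums and multiples may lose keys.\<close>

lemma linear_ext_superset:
  assumes "finite S" "Poly_Mapping.keys v \<subseteq> S"
  shows "linear_ext f v = (\<Sum>T\<in>S. vscale (Poly_Mapping.lookup v T) (f T))"
  unfolding linear_ext_def using assms
  by (intro sum.mono_neutral_left) (auto simp: in_keys_iff)

lemma linear_linear_ext: "Vector_Spaces.linear vscale vscale (linear_ext f)"
proof (intro Vector_Spaces.linear_iff[THEN iffD2] conjI allI vector_space_vscale)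
  show "linear_ext f (v + w) = linear_ext f v + linear_ext f w" for v w
  proof -
    let ?S = "Poly_Mapping.keys v \<union> Poly_Mapping.keys w"
    have "Poly_Mapping.keys (v + w) \<subseteq> ?S" by (rule Poly_Mapping.keys_add)
    then show ?thesis
      by (simp add: linear_ext_superset[of ?S] lookup_add pm.scale_left_distrib sum.distrib)
  qed
  show "linear_ext f (vscale c v) = vscale c (linear_ext f v)" for c v
  proof -
    have "Poly_Mapping.keys (vscale c v) \<subseteq> Poly_Mapping.keys v" by (auto simp: in_keys_iff)
    then show ?thesis
      by (simp add: linear_ext_superset[of "Poly_Mapping.keys v"] pm.scale_sum_right)
  qed
qed

lemma linear_ext_basis_vec [simp]: "linear_ext f (basis_vec T) = f T"
  by (simp add: linear_ext_def basis_vec_def)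

lemma linear_ext_id: "linear_ext basis_vec v = v"
  by (rule poly_mapping_eqI)
    (auto simp: linear_ext_def lookup_sum basis_vec_def lookup_single when_def in_keys_iff
      sum.delta' mult.commute if_distrib cong: if_cong)

text \<open>As a span, \<open>V_comp \<alpha>\<close> admits the usual principle that linear maps
  are controlled on a spanning set, so identities and closure reduce to tableaux.\<close>

lemma V_comp_eq_span:
  "(V_comp \<alpha> :: (filling \<Rightarrow>\<^sub>0 'k::field) set) = pm.span (basis_vec ` SRCT \<alpha>)"
proof
  show "(V_comp \<alpha> :: (filling \<Rightarrow>\<^sub>0 'k) set) \<subseteq> pm.span (basis_vec ` SRCT \<alpha>)"
  proof
    fix v :: "filling \<Rightarrow>\<^sub>0 'k" assume "v \<in> V_comp \<alpha>"
    then have "linear_ext basis_vec v \<in> pm.span (basis_vec ` SRCT \<alpha>)"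
      unfolding linear_ext_def V_comp_def
      by (intro pm.span_sum pm.span_scale pm.span_base) auto
    then show "v \<in> pm.span (basis_vec ` SRCT \<alpha>)" by (simp add: linear_ext_id)
  qed
  have "pm.subspace (V_comp \<alpha> :: (filling \<Rightarrow>\<^sub>0 'k) set)"
  proof (rule pm.subspaceI)
    show "x + y \<in> V_comp \<alpha>" if "x \<in> V_comp \<alpha>" "y \<in> V_comp \<alpha>" for x y :: "filling \<Rightarrow>\<^sub>0 'k"
      using that Poly_Mapping.keys_add[of x y] by (auto simp: V_comp_def)
  qed (auto simp: V_comp_def in_keys_iff)
  then show "pm.span (basis_vec ` SRCT \<alpha>) \<subseteq> (V_comp \<alpha> :: (filling \<Rightarrow>\<^sub>0 'k) set)"
    by (intro pm.span_minimal) (auto simp: V_comp_def basis_vec_def)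
qed

lemma linear_eq_on_V_comp:
  assumes "Vector_Spaces.linear vscale vscale f" "Vector_Spaces.linear vscale vscale g"
    and "\<And>T. T \<in> SRCT \<alpha> \<Longrightarrow> f (basis_vec T) = g (basis_vec T)" "v \<in> V_comp \<alpha>"
  shows "f v = g v"
  using assms by (intro pmp.linear_eq_on[of f g v "basis_vec ` SRCT \<alpha>"]) (auto simp: V_comp_eq_span)

lemma linear_V_comp_closed:
  assumes "Vector_Spaces.linear vscale vscale f"
    and "\<And>T. T \<in> SRCT \<alpha> \<Longrightarrow> f (basis_vec T) \<in> V_comp \<beta>" "v \<in> V_comp \<alpha>"
  shows "f v \<in> V_comp \<beta>"
proof -
  have "f v \<in> pm.span (f ` basis_vec ` SRCT \<alpha>)"
    using pmp.linear_span_image[OF assms(1)] assms(3) by (auto simp: V_comp_eq_span)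
  also have "\<dots> \<subseteq> V_comp \<beta>"
    using assms(2) unfolding V_comp_eq_span by (intro pm.span_minimal) auto
  finally show ?thesis .
qed

lemma basis_vec_in_V_comp [simp]: "T \<in> SRCT \<alpha> \<Longrightarrow> basis_vec T \<in> V_comp \<alpha>"
  by (auto simp: V_comp_eq_span intro: pm.span_base)


section \<open>The 0-Hecke action on injective fillings\<close>

text \<open>Taking boxes instead of entries makes the condition independent of the filling, so it
  can be reused after entries have moved.\<close>

definition box_attacking :: "nat \<times> nat \<Rightarrow> nat \<times> nat \<Rightarrow> bool" where
  "box_attacking p q \<longleftrightarrow> snd p = snd q \<or> (snd q = snd p + 1 \<and> fst p < fst q)"

lemma linear_hecke_act: "Vector_Spaces.linear vscale vscale (hecke_act \<alpha> i)"
  unfolding hecke_act_def by (rule linear_linear_ext)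

lemma linear_\<Phi>: "Vector_Spaces.linear vscale vscale (\<Phi> \<alpha>)"
  unfolding \<Phi>_def by (rule linear_linear_ext)

lemmas hecke_act_add = pmp.linear_add[OF linear_hecke_act]
lemmas hecke_act_zero = pmp.linear_0[OF linear_hecke_act]

lemma \<Phi>_basis_vec: "\<Phi> \<alpha> (basis_vec T) = basis_vec (add_box \<alpha> T)"
  by (simp add: \<Phi>_def)

text \<open>Asking only for injectivity lets the formula evaluate swapped fillings without first
  showing that they are tableaux.\<close>

lemma hecke_act_basis_vec:
  assumes "inj_on T (diagram \<alpha>)" "p \<in> diagram \<alpha>" "q \<in> diagram \<alpha>" "T p = i" "T q = Suc i"
    and "i \<in> {1..<sum_list \<alpha>}"
  shows "hecke_act \<alpha> i (basis_vec T) =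
    (if snd q < snd p then 0
     else if box_attacking p q then basis_vec T
     else basis_vec (swap_entries i T) + basis_vec T)"
proof -
  have "the_inv_into (diagram \<alpha>) T i = p" "the_inv_into (diagram \<alpha>) T (Suc i) = q"
    using assms(1-5) the_inv_into_f_f[OF assms(1)] by fastforce+
  then show ?thesis
    using assms(6)
    by (auto simp: hecke_act_def Des_def attacking_def box_attacking_def row_of_def col_of_def)
qed

lemma inj_on_swap_entries: "inj_on T A \<Longrightarrow> inj_on (swap_entries i T) A"
  unfolding swap_entries_def by (intro comp_inj_on) (auto intro: inj_on_subset[OF inj_transpose])

text \<open>A free pair has \<open>p\<close> strictly left of \<open>q\<close>, so the swapped
  filling is inverted and the second application kills it.\<close>

lemma hecke_act_idem_basis:
  assumes "inj_on T (diagram \<alpha>)" "p \<in> diagram \<alpha>" "q \<in> diagram \<alpha>" "T p = i" "T q = Suc i"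
    and "i \<in> {1..<sum_list \<alpha>}"
  shows "hecke_act \<alpha> i (hecke_act \<alpha> i (basis_vec T)) = hecke_act \<alpha> i (basis_vec T)"
proof -
  have "swap_entries i T q = i" "swap_entries i T p = Suc i"
    using assms by (simp_all add: swap_entries_def)
  from hecke_act_basis_vec[OF inj_on_swap_entries[OF assms(1)] assms(3,2) this assms(6)]
  show ?thesis
    by (auto simp: hecke_act_basis_vec[OF assms] hecke_act_add hecke_act_zero box_attacking_def)
qed

text \<open>The four entries are distinct, so each swap leaves the boxes of the other pair alone:
  the case met by one generator does not depend on whether the other has acted.\<close>

lemma hecke_act_comm_basis:
  assumes "inj_on T (diagram \<alpha>)"
    and "p \<in> diagram \<alpha>" "q \<in> diagram \<alpha>" "T p = i" "T q = Suc i" "i \<in> {1..<sum_list \<alpha>}"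
    and "p' \<in> diagram \<alpha>" "q' \<in> diagram \<alpha>" "T p' = j" "T q' = Suc j" "j \<in> {1..<sum_list \<alpha>}"
    and "\<bar>int i - int j\<bar> > 1"
  shows "hecke_act \<alpha> i (hecke_act \<alpha> j (basis_vec T)) = hecke_act \<alpha> j (hecke_act \<alpha> i (basis_vec T))"
proof -
  have d: "i \<noteq> j" "i \<noteq> Suc j" "j \<noteq> Suc i" using assms(12) by auto
  have j: "swap_entries j T p = i" "swap_entries j T q = Suc i"
    and i: "swap_entries i T p' = j" "swap_entries i T q' = Suc j"
    using assms(4,5,9,10) d by (auto simp: swap_entries_def transpose_def)
  have c: "swap_entries i (swap_entries j T) = swap_entries j (swap_entries i T)"
    using d by (auto simp: swap_entries_def transpose_def fun_eq_iff)
  note act = hecke_act_basis_vec[OF assms(1-6)] hecke_act_basis_vec[OF assms(1,7-11)]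
    hecke_act_basis_vec[OF inj_on_swap_entries[OF assms(1)] assms(2,3) j assms(6)]
    hecke_act_basis_vec[OF inj_on_swap_entries[OF assms(1)] assms(7,8) i assms(11)]
  show ?thesis
    by (simp add: act hecke_act_add hecke_act_zero c add_ac)
qed

text \<open>\<open>e x y z\<close> stands for the filling with \<open>i\<close>, \<open>i + 1\<close>, \<open>i + 2\<close> in the boxes \<open>x\<close>, \<open>y\<close>, \<open>z\<close>.\<close>

lemma braid_three_boxes:
  fixes P Q :: "'v::ab_group_add \<Rightarrow> 'v" and e :: "nat \<times> nat \<Rightarrow> nat \<times> nat \<Rightarrow> nat \<times> nat \<Rightarrow> 'v"
  assumes add: "\<And>v w. P (v + w) = P v + P w" "\<And>v w. Q (v + w) = Q v + Q w"
    and zero: "P 0 = 0" "Q 0 = 0"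
    and P: "\<And>x y z. {x, y, z} = {p, q, r} \<Longrightarrow> P (e x y z) =
      (if snd y < snd x then 0 else if box_attacking x y then e x y z else e y x z + e x y z)"
    and Q: "\<And>x y z. {x, y, z} = {p, q, r} \<Longrightarrow> Q (e x y z) =
      (if snd z < snd y then 0 else if box_attacking y z then e x y z else e x z y + e x y z)"
  shows "P (Q (P (e p q r))) = Q (P (Q (e p q r)))"
proof -
  \<comment> \<open>Together with the identity these are the six arrangements of the three
    boxes.\<close>
  have sets: "{p, r, q} = {p, q, r}" "{q, p, r} = {p, q, r}" "{q, r, p} = {p, q, r}"
    "{r, p, q} = {p, q, r}" "{r, q, p} = {p, q, r}"
    by auto
  note PQ = P[OF HOL.refl] P[OF sets(1)] P[OF sets(2)] P[OF sets(3)] P[OF sets(4)] P[OF sets(5)]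
    Q[OF HOL.refl] Q[OF sets(1)] Q[OF sets(2)] Q[OF sets(3)] Q[OF sets(4)] Q[OF sets(5)]
  have free: "snd x < snd y" if "\<not> snd y < snd x" "\<not> box_attacking x y" for x y :: "nat \<times> nat"
    using that by (auto simp: box_attacking_def)
  \<comment> \<open>Inverted, attacking or free. The free case records the strict inequality, by
    which the reversed pair is recognised as inverted.\<close>
  have split: thesis
    if "snd y < snd x \<Longrightarrow> thesis"
      "\<not> snd y < snd x \<Longrightarrow> box_attacking x y \<Longrightarrow> thesis"
      "\<not> snd y < snd x \<Longrightarrow> \<not> box_attacking x y \<Longrightarrow> snd x < snd y \<Longrightarrow> thesis"
    for thesis and x y :: "nat \<times> nat"
    using that free by blast
  \<comment> \<open>Two strict moves to the right leave \<open>p\<close> and \<open>r\<close> at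
    least two columns apart, too far to attack.\<close>
  have free_trans: "\<not> box_attacking p r" if "snd p < snd q" "snd q < snd r"
    using that by (auto simp: box_attacking_def)
  show ?thesis
    by (rule split[of q p]; rule split[of r q]; rule split[of r p];
        simp add: PQ add zero add_ac free_trans)
qed

text \<open>Both generators only permute three entries among \<open>p\<close>, \<open>q\<close>,
  \<open>r\<close>, so the fillings that occur are the \<open>S x y z\<close> and
  \<open>braid_three_boxes\<close> applies. The hypothesis \<open>out\<close> is there because a
  swap acts on every box, also outside the diagram.\<close>

lemma hecke_act_braid_basis:
  fixes T :: filling
  assumes inj: "inj_on T (diagram \<alpha>)" and out: "\<And>b. b \<notin> diagram \<alpha> \<Longrightarrow> T b = 0"
    and box: "p \<in> diagram \<alpha>" "q \<in> diagram \<alpha>" "r \<in> diagram \<alpha>"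
    and T: "T p = i" "T q = Suc i" "T r = Suc (Suc i)"
    and i: "i \<in> {1..<sum_list \<alpha>}" "Suc i \<in> {1..<sum_list \<alpha>}"
  shows "hecke_act \<alpha> i (hecke_act \<alpha> (Suc i) (hecke_act \<alpha> i (basis_vec T :: filling \<Rightarrow>\<^sub>0 'k::field))) =
    hecke_act \<alpha> (Suc i) (hecke_act \<alpha> i (hecke_act \<alpha> (Suc i) (basis_vec T)))"
proof -
  define S where "S x y z = T(x := i, y := Suc i, z := Suc (Suc i))" for x y z
  have rest: "T b \<noteq> i" "T b \<noteq> Suc i" "T b \<noteq> Suc (Suc i)" if "b \<notin> {p, q, r}" for b
  proof -
    have "T b \<noteq> T p \<and> T b \<noteq> T q \<and> T b \<noteq> T r"
    proof (cases "b \<in> diagram \<alpha>")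
      case True
      then show ?thesis using that box inj_on_eq_iff[OF inj] by auto
    next
      case False
      \<comment> \<open>The default entry \<open>0\<close> differs from the three entries because
        \<open>i\<close> is positive.\<close>
      then show ?thesis using out[OF False] T i by simp
    qed
    then show "T b \<noteq> i" "T b \<noteq> Suc i" "T b \<noteq> Suc (Suc i)" using T by auto
  qed
  have pqr: "p \<noteq> q" "p \<noteq> r" "q \<noteq> r" using T by auto
  have S: "inj_on (S x y z) (diagram \<alpha>)" "S x y z x = i" "S x y z y = Suc i"
      "S x y z z = Suc (Suc i)" "x \<in> diagram \<alpha>" "y \<in> diagram \<alpha>" "z \<in> diagram \<alpha>"
      "swap_entries i (S x y z) = S y x z" "swap_entries (Suc i) (S x y z) = S x z y"
    if xyz: "{x, y, z} = {p, q, r}" for x y z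
  proof -
    have "card {x, y, z} = 3" using xyz pqr by simp
    then have d: "x \<noteq> y" "x \<noteq> z" "y \<noteq> z" by (auto simp: card_insert_if split: if_splits)
    then show "S x y z x = i" "S x y z y = Suc i" "S x y z z = Suc (Suc i)"
      by (auto simp: S_def)
    have rest': "T b \<noteq> i \<and> T b \<noteq> Suc i \<and> T b \<noteq> Suc (Suc i)" if "b \<noteq> x" "b \<noteq> y" "b \<noteq> z" for b
      using rest[of b] that xyz by blast
    show "x \<in> diagram \<alpha>" "y \<in> diagram \<alpha>" "z \<in> diagram \<alpha>"
    proof -
      have "{x, y, z} \<subseteq> diagram \<alpha>" using box unfolding xyz by simp
      then show "x \<in> diagram \<alpha>" "y \<in> diagram \<alpha>" "z \<in> diagram \<alpha>" by simp_all
    qed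
    show "swap_entries i (S x y z) = S y x z" "swap_entries (Suc i) (S x y z) = S x z y"
      using d rest' by (auto simp: S_def swap_entries_def fun_eq_iff transpose_def)
    show "inj_on (S x y z) (diagram \<alpha>)"
    proof (rule inj_onI)
      fix b c assume "b \<in> diagram \<alpha>" "c \<in> diagram \<alpha>" "S x y z b = S x y z c"
      then show "b = c"
        using d rest'[of b] rest'[of c] inj_onD[OF inj, of b c]
        by (auto simp: S_def split: if_splits)
    qed
  qed
  let ?E = "\<lambda>x y z. basis_vec (S x y z) :: filling \<Rightarrow>\<^sub>0 'k"
  have "T = S p q r" using T by (auto simp: S_def)
  moreover have "hecke_act \<alpha> i (hecke_act \<alpha> (Suc i) (hecke_act \<alpha> i (?E p q r))) =
    hecke_act \<alpha> (Suc i) (hecke_act \<alpha> i (hecke_act \<alpha> (Suc i) (?E p q r)))"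
  proof (rule braid_three_boxes[where e = "?E"])
    fix x y z assume xyz: "{x, y, z} = {p, q, r}"
    show "hecke_act \<alpha> i (?E x y z) =
      (if snd y < snd x then 0 else if box_attacking x y then ?E x y z
       else ?E y x z + ?E x y z)"
      by (simp add: hecke_act_basis_vec[OF S(1,5,6,2,3)[OF xyz] i(1)] S(8)[OF xyz])
    show "hecke_act \<alpha> (Suc i) (?E x y z) =
      (if snd z < snd y then 0 else if box_attacking y z then ?E x y z
       else ?E x z y + ?E x y z)"
      by (simp add: hecke_act_basis_vec[OF S(1,6,7,3,4)[OF xyz] i(2)] S(9)[OF xyz])
  qed (simp_all add: hecke_act_add hecke_act_zero)
  ultimately show ?thesis by simp
qed


section \<open>Standard reverse composition tableaux under swaps and box additions\<close>

lemma SRCT_inj: "T \<in> SRCT \<alpha> \<Longrightarrow> inj_on T (diagram \<alpha>)"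
  by (auto simp: SRCT_def bij_betw_def)

lemma SRCT_bij: "T \<in> SRCT \<alpha> \<Longrightarrow> bij_betw T (diagram \<alpha>) {1..sum_list \<alpha>}"
  by (simp add: SRCT_def)

lemma SRCT_outside: "T \<in> SRCT \<alpha> \<Longrightarrow> b \<notin> diagram \<alpha> \<Longrightarrow> T b = 0"
  unfolding SRCT_def by blast

lemma SRCT_row:
  "\<lbrakk>T \<in> SRCT \<alpha>; (k, j) \<in> diagram \<alpha>; (k, j') \<in> diagram \<alpha>; j < j'\<rbrakk> \<Longrightarrow> T (k, j) > T (k, j')"
  unfolding SRCT_def by blast

lemma SRCT_first_column:
  "\<lbrakk>T \<in> SRCT \<alpha>; (k, 1) \<in> diagram \<alpha>; (k', 1) \<in> diagram \<alpha>; k < k'\<rbrakk> \<Longrightarrow> T (k, 1) < T (k', 1)"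
  unfolding SRCT_def by blast

lemma SRCT_triple:
  "\<lbrakk>T \<in> SRCT \<alpha>; (a, k) \<in> diagram \<alpha>; (b, k + 1) \<in> diagram \<alpha>; a < b; T (a, k) > T (b, k + 1)\<rbrakk> \<Longrightarrow>
    (a, k + 1) \<in> diagram \<alpha> \<and> T (a, k + 1) > T (b, k + 1)"
  unfolding SRCT_def by blast

lemma SRCT_box:
  assumes "T \<in> SRCT \<alpha>" "a \<in> {1..sum_list \<alpha>}"
  obtains p where "p \<in> diagram \<alpha>" "T p = a"
  using SRCT_bij[OF assms(1)] assms(2) by (metis bij_betw_iff_bijections)

text \<open>No number lies strictly between \<open>i\<close> and \<open>Suc i\<close>, so exchanging
  them reverses only their own comparison.\<close>

lemma transpose_Suc_less_iff:
  assumes "\<not> (a = i \<and> b = Suc i)" "\<not> (a = Suc i \<and> b = i)"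
  shows "transpose i (Suc i) a < transpose i (Suc i) b \<longleftrightarrow> a < b"
  using assms by (auto simp: transpose_def)

text \<open>Only the comparison of \<open>p\<close> with \<open>q\<close> changes, so each tableau
  condition survives once it is seen not to compare these two boxes.\<close>

lemma swap_entries_SRCT:
  assumes T: "T \<in> SRCT \<alpha>" and p: "p \<in> diagram \<alpha>" "T p = i" and q: "q \<in> diagram \<alpha>" "T q = Suc i"
    and i: "i \<in> {1..<sum_list \<alpha>}" and free: "snd p \<le> snd q" "\<not> box_attacking p q"
  shows "swap_entries i T \<in> SRCT \<alpha>"
proof -
  have inj: "inj_on T (diagram \<alpha>)" using T by (rule SRCT_inj)
  have col: "snd p < snd q" using free by (auto simp: box_attacking_def)
  have less_iff: "swap_entries i T a < swap_entries i T b \<longleftrightarrow> T a < T b"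
    if "a \<in> diagram \<alpha>" "b \<in> diagram \<alpha>" "(a, b) \<noteq> (p, q)" "(a, b) \<noteq> (q, p)" for a b
  proof -
    have "T c = i \<longleftrightarrow> c = p" "T c = Suc i \<longleftrightarrow> c = q" if "c \<in> diagram \<alpha>" for c
      using that p q inj_on_eq_iff[OF inj, of c] by metis+
    then show ?thesis
      using that transpose_Suc_less_iff[of "T a" i "T b"] by (simp add: swap_entries_def)
  qed
  \<comment> \<open>Rows decrease to the right, but \<open>q\<close> lies right of \<open>p\<close>
    and holds the larger entry.\<close>
  have row: "fst p \<noteq> fst q"
  proof
    assume "fst p = fst q"
    then have "T p > T q"
      using SRCT_row[OF T] p(1) q(1) col by (cases p; cases q) auto
    then show False using p q by simp
  qed
  have "bij_betw (transpose i (Suc i)) {1..sum_list \<alpha>} {1..sum_list \<alpha>}"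
    using i by (intro Transposition.bij_betw_transpose_iff) auto
  then have bij: "bij_betw (swap_entries i T) (diagram \<alpha>) {1..sum_list \<alpha>}"
    using bij_betw_trans[OF SRCT_bij[OF T]] by (simp add: swap_entries_def)
  have zero: "swap_entries i T b = 0" if "b \<notin> diagram \<alpha>" for b
    using SRCT_outside[OF T that] i by (simp add: swap_entries_def transpose_def)
  have rows: "swap_entries i T (k, j) > swap_entries i T (k, j')"
    if "(k, j) \<in> diagram \<alpha>" "(k, j') \<in> diagram \<alpha>" "j < j'" for k j j'
    using that SRCT_row[OF T that] row by (subst less_iff) auto
  have col1: "swap_entries i T (k, 1) < swap_entries i T (k', 1)"
    if "(k, 1) \<in> diagram \<alpha>" "(k', 1) \<in> diagram \<alpha>" "k < k'" for k k'
    using that SRCT_first_column[OF T that] col by (subst less_iff) auto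
  \<comment> \<open>If \<open>(a, k)\<close> and \<open>(b, k + 1)\<close> were \<open>p\<close> and
    \<open>q\<close>, the pair would be attacking; the opposite order puts \<open>q\<close> left of
    \<open>p\<close>. The conclusion compares boxes of one column, whereas \<open>p\<close> and
    \<open>q\<close> lie in different ones.\<close>
  have triple: "(a, k + 1) \<in> diagram \<alpha> \<and> swap_entries i T (a, k + 1) > swap_entries i T (b, k + 1)"
    if *: "(a, k) \<in> diagram \<alpha>" "(b, k + 1) \<in> diagram \<alpha>" "a < b"
      "swap_entries i T (a, k) > swap_entries i T (b, k + 1)" for a b k
  proof -
    have "T (a, k) > T (b, k + 1)"
      using * free col by (subst (asm) less_iff) (auto simp: box_attacking_def)
    then have "(a, k + 1) \<in> diagram \<alpha>" "T (a, k + 1) > T (b, k + 1)"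
      using SRCT_triple[OF T *(1-3)] by blast+
    then show ?thesis using * col by (subst less_iff) auto
  qed
  show ?thesis
    unfolding SRCT_def using bij zero rows col1 triple by blast
qed

lemma hecke_act_SRCT_closed:
  assumes "T \<in> SRCT \<alpha>" "i \<in> {1..<sum_list \<alpha>}"
  shows "hecke_act \<alpha> i (basis_vec T) \<in> V_comp \<alpha>"
proof -
  obtain p where p: "p \<in> diagram \<alpha>" "T p = i" using SRCT_box[OF assms(1), of i] assms(2) by auto
  obtain q where q: "q \<in> diagram \<alpha>" "T q = Suc i"
    using SRCT_box[OF assms(1), of "Suc i"] assms(2) by auto
  show ?thesis
    using swap_entries_SRCT[OF assms(1) p q assms(2)] assms(1)
    unfolding hecke_act_basis_vec[OF SRCT_inj[OF assms(1)] p(1) q(1) p(2) q(2) assms(2)]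
    by (auto simp: V_comp_eq_span pm.span_base pm.span_zero intro!: pm.span_add)
qed

section \<open>Adding a box at the bottom of the first column\<close>

lemma diagram_append_1: "diagram (\<alpha> @ [1]) = insert (length \<alpha> + 1, 1) (diagram \<alpha>)"
  by (auto simp: diagram_def nth_append split: if_splits)

lemma new_box_notin_diagram: "(length \<alpha> + 1, j) \<notin> diagram \<alpha>"
  by (simp add: diagram_def)

text \<open>The new box is alone in its row and can occupy neither position compared in the
  hypothesis of the triple condition. In the first column it is the lowest box and holds the largest
  entry.\<close>

lemma add_box_SRCT:
  assumes T: "T \<in> SRCT \<alpha>"
  shows "add_box \<alpha> T \<in> SRCT (\<alpha> @ [1])"
proof -
  let ?b = "(length \<alpha> + 1, 1 :: nat)" and ?T = "add_box \<alpha> T"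
  have old: "?T b = T b" if "b \<in> diagram \<alpha>" for b
    using that new_box_notin_diagram by (auto simp: add_box_def)
  have new: "?T ?b = Suc (sum_list \<alpha>)" by (simp add: add_box_def)
  have lt: "T b < Suc (sum_list \<alpha>)" if "b \<in> diagram \<alpha>" for b
    using bij_betw_apply[OF SRCT_bij[OF T] that] by simp
  have row: "a \<le> length \<alpha>" if "(a, j) \<in> diagram \<alpha>" for a j
    using that by (simp add: diagram_def)
  have pos: "0 < j" if "(a, j) \<in> diagram \<alpha>" for a j
    using that by (simp add: diagram_def)
  have bijT: "bij_betw ?T (diagram \<alpha>) {1..sum_list \<alpha>}"
    using SRCT_bij[OF T] bij_betw_cong[of "diagram \<alpha>" ?T T] old by blast
  have "bij_betw ?T (diagram \<alpha> \<union> {?b}) ({1..sum_list \<alpha>} \<union> {?T ?b})"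
    using notIn_Un_bij_betw[OF _ _ bijT, of ?b] new_box_notin_diagram new by auto
  then have bij: "bij_betw ?T (diagram (\<alpha> @ [1])) {1..sum_list (\<alpha> @ [1])}"
    unfolding new diagram_append_1 by (simp add: atLeastAtMostSuc_conv)
  have zero: "?T b = 0" if "b \<notin> diagram (\<alpha> @ [1])" for b
    using that SRCT_outside[OF T] unfolding diagram_append_1 by (auto simp: add_box_def)
  have rows: "?T (k, j) > ?T (k, j')"
    if "(k, j) \<in> diagram (\<alpha> @ [1])" "(k, j') \<in> diagram (\<alpha> @ [1])" "j < j'" for k j j'
  proof -
    have "k \<noteq> length \<alpha> + 1"
    proof
      assume k: "k = length \<alpha> + 1"
      then have "j = 1" "j' = 1"
        using that(1,2) new_box_notin_diagram unfolding diagram_append_1 by auto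
      then show False using that(3) by simp
    qed
    then have "(k, j) \<in> diagram \<alpha>" "(k, j') \<in> diagram \<alpha>"
      using that(1,2) unfolding diagram_append_1 by simp_all
    then show ?thesis using SRCT_row[OF T _ _ that(3)] old by simp
  qed
  have col1: "?T (k, 1) < ?T (k', 1)"
    if "(k, 1) \<in> diagram (\<alpha> @ [1])" "(k', 1) \<in> diagram (\<alpha> @ [1])" "k < k'" for k k'
  proof -
    have "(k, 1) \<in> diagram \<alpha>" using that row unfolding diagram_append_1 by fastforce
    moreover have "(k', 1) \<in> diagram \<alpha> \<or> k' = length \<alpha> + 1" using that unfolding diagram_append_1 by auto
    ultimately show ?thesis
      using SRCT_first_column[OF T _ _ that(3)] old lt[of "(k, 1)"] new by auto
  qed
  have triple: "(a, k + 1) \<in> diagram (\<alpha> @ [1]) \<and> ?T (a, k + 1) > ?T (b, k + 1)"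
    if *: "(a, k) \<in> diagram (\<alpha> @ [1])" "(b, k + 1) \<in> diagram (\<alpha> @ [1])" "a < b"
      "?T (a, k) > ?T (b, k + 1)" for a b k
  proof -
    \<comment> \<open>Since \<open>k\<close> is positive, column \<open>k + 1\<close> misses the new
      box; then \<open>a < b\<close> keeps \<open>(a, k)\<close> out of the last row.\<close>
    have b: "(b, k + 1) \<in> diagram \<alpha>" using *(1,2) pos unfolding diagram_append_1 by auto
    then have a: "(a, k) \<in> diagram \<alpha>" using *(1,3) row unfolding diagram_append_1 by fastforce
    have "(a, k + 1) \<in> diagram \<alpha> \<and> T (a, k + 1) > T (b, k + 1)"
      using SRCT_triple[OF T a b *(3)] *(4) old[OF a] old[OF b] by simp
    then show ?thesis using old b unfolding diagram_append_1 by simp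
  qed
  show ?thesis
    unfolding SRCT_def using bij zero rows col1 triple by blast
qed

text \<open>Both entries keep their boxes, hence their case, and the swap does not touch the new
  entry, which exceeds them.\<close>

lemma hecke_act_\<Phi>_basis:
  assumes T: "T \<in> SRCT \<alpha>" and i: "i \<in> {1..<sum_list \<alpha>}"
  shows "hecke_act (\<alpha> @ [1]) i (\<Phi> \<alpha> (basis_vec T)) = \<Phi> \<alpha> (hecke_act \<alpha> i (basis_vec T))"
proof -
  obtain p where p: "p \<in> diagram \<alpha>" "T p = i" using SRCT_box[OF T, of i] i by auto
  obtain q where q: "q \<in> diagram \<alpha>" "T q = Suc i" using SRCT_box[OF T, of "Suc i"] i by auto
  have "p \<noteq> (length \<alpha> + 1, 1)" "q \<noteq> (length \<alpha> + 1, 1)" using p q new_box_notin_diagram by blast+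
  then have pq: "add_box \<alpha> T p = i" "add_box \<alpha> T q = Suc i" using p q by (simp_all add: add_box_def)
  have mem: "p \<in> diagram (\<alpha> @ [1])" "q \<in> diagram (\<alpha> @ [1])" "i \<in> {1..<sum_list (\<alpha> @ [1])}"
    using p q i unfolding diagram_append_1 by auto
  have "swap_entries i (add_box \<alpha> T) = add_box \<alpha> (swap_entries i T)"
    using i by (auto simp: swap_entries_def add_box_def fun_eq_iff transpose_def)
  then show ?thesis
    by (simp del: One_nat_def add: \<Phi>_basis_vec
        hecke_act_basis_vec[OF SRCT_inj[OF add_box_SRCT[OF T]] mem(1,2) pq mem(3)]
        hecke_act_basis_vec[OF SRCT_inj[OF T] p(1) q(1) p(2) q(2) i]
        pmp.linear_add[OF linear_\<Phi>] pmp.linear_0[OF linear_\<Phi>])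
qed

text \<open>The two new boxes lie in the first column, so their entries form an attacking
  descent.\<close>

lemma hecke_act_\<Phi>_\<Phi>_basis:
  assumes T: "T \<in> SRCT \<alpha>"
  shows "hecke_act (\<alpha> @ [1] @ [1]) (Suc (sum_list \<alpha>)) (\<Phi> (\<alpha> @ [1]) (\<Phi> \<alpha> (basis_vec T))) =
    \<Phi> (\<alpha> @ [1]) (\<Phi> \<alpha> (basis_vec T))"
proof -
  let ?S = "add_box (\<alpha> @ [1]) (add_box \<alpha> T)"
  have "?S \<in> SRCT ((\<alpha> @ [1]) @ [1])" by (intro add_box_SRCT T)
  moreover have "(length \<alpha> + 1, 1) \<in> diagram ((\<alpha> @ [1]) @ [1])"
    "(length \<alpha> + 2, 1) \<in> diagram ((\<alpha> @ [1]) @ [1])"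
    unfolding diagram_append_1 by simp_all
  ultimately have "hecke_act ((\<alpha> @ [1]) @ [1]) (Suc (sum_list \<alpha>)) (basis_vec ?S) = basis_vec ?S"
    by (subst hecke_act_basis_vec[OF SRCT_inj, of _ _ "(length \<alpha> + 1, 1)" "(length \<alpha> + 2, 1)"])
      (auto simp: add_box_def box_attacking_def)
  then show ?thesis by (simp add: \<Phi>_basis_vec)
qed


section \<open>The tower of the modules \<open>\<V>\<^sub>\<alpha>\<close>\<close>

lemma linear_hecke_act_comp:
  "Vector_Spaces.linear vscale vscale f \<Longrightarrow> Vector_Spaces.linear vscale vscale (\<lambda>v. hecke_act \<alpha> i (f v))"
  using Vector_Spaces.linear_compose[OF _ linear_hecke_act] by (simp add: comp_def)

lemma linear_\<Phi>_comp:
  "Vector_Spaces.linear vscale vscale f \<Longrightarrow> Vector_Spaces.linear vscale vscale (\<lambda>v. \<Phi> \<alpha> (f v))"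
  using Vector_Spaces.linear_compose[OF _ linear_\<Phi>] by (simp add: comp_def)

lemmas linear_intros = linear_hecke_act linear_\<Phi> linear_hecke_act_comp linear_\<Phi>_comp

lemma hecke_act_closed:
  "i \<in> {1..<sum_list \<alpha>} \<Longrightarrow> v \<in> V_comp \<alpha> \<Longrightarrow> hecke_act \<alpha> i v \<in> V_comp \<alpha>"
  by (rule linear_V_comp_closed[OF linear_hecke_act hecke_act_SRCT_closed])

lemma \<Phi>_closed: "v \<in> V_comp \<alpha> \<Longrightarrow> \<Phi> \<alpha> v \<in> V_comp (\<alpha> @ [1])"
  by (rule linear_V_comp_closed[OF linear_\<Phi>]) (simp_all del: One_nat_def add: \<Phi>_basis_vec add_box_SRCT)

lemma hecke_act_idem:
  assumes "i \<in> {1..<sum_list \<alpha>}" "v \<in> V_comp \<alpha>"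
  shows "hecke_act \<alpha> i (hecke_act \<alpha> i v) = hecke_act \<alpha> i v"
proof (rule linear_eq_on_V_comp[OF _ _ _ assms(2)])
  fix T assume T: "T \<in> SRCT \<alpha>"
  have "i \<in> {1..sum_list \<alpha>}" "Suc i \<in> {1..sum_list \<alpha>}" using assms(1) by auto
  then obtain p q where "p \<in> diagram \<alpha>" "q \<in> diagram \<alpha>" "T p = i" "T q = Suc i"
    using SRCT_box[OF T] by metis
  then show "hecke_act \<alpha> i (hecke_act \<alpha> i (basis_vec T)) = hecke_act \<alpha> i (basis_vec T)"
    by (intro hecke_act_idem_basis SRCT_inj[OF T] assms(1))
qed (intro linear_intros)+

lemma hecke_act_comm:
  assumes "i \<in> {1..<sum_list \<alpha>}" "j \<in> {1..<sum_list \<alpha>}" "\<bar>int i - int j\<bar> > 1" "v \<in> V_comp \<alpha>"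
  shows "hecke_act \<alpha> i (hecke_act \<alpha> j v) = hecke_act \<alpha> j (hecke_act \<alpha> i v)"
proof (rule linear_eq_on_V_comp[OF _ _ _ assms(4)])
  fix T assume T: "T \<in> SRCT \<alpha>"
  have "i \<in> {1..sum_list \<alpha>}" "Suc i \<in> {1..sum_list \<alpha>}"
    "j \<in> {1..sum_list \<alpha>}" "Suc j \<in> {1..sum_list \<alpha>}" using assms(1,2) by auto
  then obtain p q p' q' where "p \<in> diagram \<alpha>" "q \<in> diagram \<alpha>" "T p = i" "T q = Suc i"
    "p' \<in> diagram \<alpha>" "q' \<in> diagram \<alpha>" "T p' = j" "T q' = Suc j"
    using SRCT_box[OF T] by metis
  then show "hecke_act \<alpha> i (hecke_act \<alpha> j (basis_vec T)) =
      hecke_act \<alpha> j (hecke_act \<alpha> i (basis_vec T))"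
    by (intro hecke_act_comm_basis[where p = p and q = q and p' = p' and q' = q']
        SRCT_inj[OF T] assms(1-3))
qed (intro linear_intros)+

lemma hecke_act_braid:
  assumes "i \<in> {1..<sum_list \<alpha>}" "Suc i \<in> {1..<sum_list \<alpha>}" "v \<in> V_comp \<alpha>"
  shows "hecke_act \<alpha> i (hecke_act \<alpha> (Suc i) (hecke_act \<alpha> i v)) =
    hecke_act \<alpha> (Suc i) (hecke_act \<alpha> i (hecke_act \<alpha> (Suc i) v))"
proof (rule linear_eq_on_V_comp[OF _ _ _ assms(3)])
  fix T assume T: "T \<in> SRCT \<alpha>"
  have "i \<in> {1..sum_list \<alpha>}" "Suc i \<in> {1..sum_list \<alpha>}" "Suc (Suc i) \<in> {1..sum_list \<alpha>}"
    using assms(1,2) by auto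
  then obtain p q r where "p \<in> diagram \<alpha>" "q \<in> diagram \<alpha>" "r \<in> diagram \<alpha>"
    "T p = i" "T q = Suc i" "T r = Suc (Suc i)"
    using SRCT_box[OF T] by metis
  moreover have "T b = 0" if "b \<notin> diagram \<alpha>" for b using T that by (rule SRCT_outside)
  ultimately show "hecke_act \<alpha> i (hecke_act \<alpha> (Suc i) (hecke_act \<alpha> i (basis_vec T))) =
    hecke_act \<alpha> (Suc i) (hecke_act \<alpha> i (hecke_act \<alpha> (Suc i) (basis_vec T)))"
    by (intro hecke_act_braid_basis[where p = p and q = q and r = r] SRCT_inj[OF T] assms(1,2))
qed (intro linear_intros)+

lemma hecke_act_\<Phi>:
  "i \<in> {1..<sum_list \<alpha>} \<Longrightarrow> v \<in> V_comp \<alpha> \<Longrightarrow>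
    hecke_act (\<alpha> @ [1]) i (\<Phi> \<alpha> v) = \<Phi> \<alpha> (hecke_act \<alpha> i v)"
  by (rule linear_eq_on_V_comp[where \<alpha> = \<alpha>]) (intro linear_intros hecke_act_\<Phi>_basis | assumption)+

lemma hecke_act_\<Phi>_\<Phi>:
  "v \<in> V_comp \<alpha> \<Longrightarrow> hecke_act (\<alpha> @ [1] @ [1]) (Suc (sum_list \<alpha>)) (\<Phi> (\<alpha> @ [1]) (\<Phi> \<alpha> v)) =
    \<Phi> (\<alpha> @ [1]) (\<Phi> \<alpha> v)"
  by (rule linear_eq_on_V_comp[where \<alpha> = \<alpha>]) (intro linear_intros hecke_act_\<Phi>_\<Phi>_basis | assumption)+

lemma add_ones_Suc: "add_ones \<alpha> (Suc d) = add_ones \<alpha> d @ [1]"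
  by (simp add: add_ones_def replicate_append_same)

lemma sum_list_add_ones: "sum_list (add_ones \<alpha> d) = sum_list \<alpha> + d"
  by (simp add: add_ones_def sum_list_replicate)

lemma hecke_tower_add_ones:
  fixes \<tau> :: "nat list"
  assumes "sum_list \<tau> = n"
  shows "hecke_tower (vscale :: 'k::field \<Rightarrow> _)
    (\<lambda>i. if n \<le> i then V_comp (add_ones \<tau> (i - n)) else {0})
    (\<lambda>i. hecke_act (add_ones \<tau> (i - n))) (\<lambda>i. \<Phi> (add_ones \<tau> (i - n)))"
proof -
  \<comment> \<open>Below \<open>n\<close> truncated subtraction gives \<open>0\<close> on both
    sides and this fails; there the space is \<open>{0}\<close>, and linearity settles each
    axiom.\<close>
  have Suc: "add_ones \<tau> (Suc m - n) = add_ones \<tau> (m - n) @ [1]" if "n \<le> m" for m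
    using that by (simp add: Suc_diff_le add_ones_Suc)
  have sum: "sum_list (add_ones \<tau> (m - n)) = m" if "n \<le> m" for m
    using that assms by (simp add: sum_list_add_ones)
  \<comment> \<open>Covers the map into degree \<open>n\<close> from the zero space just below
    it.\<close>
  have zero: "0 \<in> V_comp \<alpha>" for \<alpha> by (simp add: V_comp_eq_span pm.span_zero)
  note zeros = hecke_act_zero pmp.linear_0[OF linear_\<Phi>]
  show ?thesis
  proof (intro hecke_tower.intro hecke_tower_axioms.intro vector_space_vscale
      linear_hecke_act linear_\<Phi>, goal_cases)
    case (1 m)
    then show ?case by (simp add: V_comp_eq_span pm.subspace_0 pm.subspace_single_0)
  next
    case (2 i m v)
    then show ?case using hecke_act_closed[of i "add_ones \<tau> (m - n)" v] sum[of m] by (auto simp: zeros split: if_splits)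
  next
    case (3 v m)
    then show ?case using \<Phi>_closed[of v "add_ones \<tau> (m - n)"] Suc[of m]
      by (auto simp: zeros zero split: if_splits)
  next
    case (4 i m v)
    then show ?case using hecke_act_idem[of i "add_ones \<tau> (m - n)" v] sum[of m] by (auto simp: zeros split: if_splits)
  next
    case (5 i m v)
    then show ?case using hecke_act_braid[of i "add_ones \<tau> (m - n)" v] sum[of m] by (auto simp: zeros split: if_splits)
  next
    case (6 i m j v)
    then show ?case using hecke_act_comm[of i "add_ones \<tau> (m - n)" j v] sum[of m] by (auto simp: zeros split: if_splits)
  next
    case (7 i m v)
    then show ?case using hecke_act_\<Phi>[of i "add_ones \<tau> (m - n)" v] sum[of m] Suc[of m]
      by (auto simp: zeros split: if_splits)
  next
    case (8 v m)
    then show ?case using hecke_act_\<Phi>_\<Phi>[of v "add_ones \<tau> (m - n)"] sum[of m] Suc[of m] Suc[of "Suc m"]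
      by (auto simp: zeros split: if_splits)
  qed
qed

theorem theorem13p8:
  fixes \<tau> :: "nat list" and n :: nat
  assumes "is_composition \<tau> n"
  shows "\<exists>F :: nat \<Rightarrow> nat \<Rightarrow> nat list set \<Rightarrow> (filling \<Rightarrow>\<^sub>0 'k::field) \<Rightarrow> (filling \<Rightarrow>\<^sub>0 'k).
    H_module vscale (\<lambda>i. if n \<le> i then V_comp (add_ones \<tau> (i - n)) else {0}) F \<and>
    (\<forall>i\<ge>n. \<forall>j\<in>{1..<i}. \<forall>v\<in>V_comp (add_ones \<tau> (i - n)).
       F i i (mor i i [j]) v = hecke_act (add_ones \<tau> (i - n)) j v) \<and>
    (\<forall>i\<ge>n. \<forall>v\<in>V_comp (add_ones \<tau> (i - n)).
       F i (i + 1) (\<iota> i (i + 1)) v = \<Phi> (add_ones \<tau> (i - n)) v)"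
proof -
  interpret t: hecke_tower "vscale :: 'k \<Rightarrow> _"
    "\<lambda>i. if n \<le> i then V_comp (add_ones \<tau> (i - n)) else {0}"
    "\<lambda>i. hecke_act (add_ones \<tau> (i - n))" "\<lambda>i. \<Phi> (add_ones \<tau> (i - n))"
    using assms by (intro hecke_tower_add_ones) (simp add: is_composition_def)
  show ?thesis
  \<comment> \<open>The last two clauses are a one-letter word without climbing, and the empty word
    after a single step up.\<close>
  proof (intro exI[of _ t.hom_act] conjI allI impI ballI)
    show "H_module vscale (\<lambda>i. if n \<le> i then V_comp (add_ones \<tau> (i - n)) else {0}) t.hom_act"
      by (rule t.H_module_hom_act)
    show "t.hom_act i i (mor i i [j]) v = hecke_act (add_ones \<tau> (i - n)) j v"
      if "n \<le> i" "j \<in> {1..<i}" "v \<in> V_comp (add_ones \<tau> (i - n))" for i j v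
      using t.hom_act_mor[of i i "[j]" v] that by simp
    show "t.hom_act i (i + 1) (\<iota> i (i + 1)) v = \<Phi> (add_ones \<tau> (i - n)) v"
      if "n \<le> i" "v \<in> V_comp (add_ones \<tau> (i - n))" for i v
      using t.hom_act_mor[of i "i + 1" "[]" v] that by (simp add: \<iota>_def)
  qed
qed

end
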